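(* Let $F$ be a non-abelian free group (of arbitrary, possibly infinite, rank). Then, for every integer $m\geq 0$, the $m$-almost-palindromic width of $F$ is infinite, i.e. $\operatorname{AP-width}(F,m)=\infty$.
   Context: Width. For a group $G$, a generating set $X\subseteq G$ and $g\in G$, let $\operatorname{length}(g,X)$ be the minimal $n\geq 0$ such that there exist $x_1,\dots,x_n\in X$ with $g=x_1^{\pm1}\cdots x_n^{\pm1}$ (for some choice of signs). Let $\operatorname{width}(G,X)=\max_{g\in G}\operatorname{length}(g,X)$, with $\operatorname{width}(G,X)=\infty$ if the maximum does not exist. Words. For a set $B$, let $B^{\pm1}=B\cup\{b^{-1}\mid b\in B\}$ (formal inverses). $W_B$ is the free monoid on $B^{\pm1}$, i.e. all (not necessarily reduced) words with letters in $B^{\pm1}$ under concatenation. $F_B$ is the free group on $B$, whose elements are the reduced words in $B^{\pm1}$, with operation concatenation followed by reduction. $r_B\colon W_B\to F_B$ is the monoid homomorphism sending a word to its reduced form. Almost-palindromes. For $w\in W_B$, $\operatorname{rev}(w)$ is the word with the letters of $w$ in reverse order. A palindrome is a word $p\in W_B$ with $p=\operatorname{rev}(p)$ (letter by letter in $W_B$). For an integer $m\geq 0$, an $m$-almost-palindrome is a word $\tilde p\in W_B$ for which there is a palindrome $p\in W_B$ with the same number of letters as $\tilde p$ that differs from $\tilde p$ in at most $m$ positions (Hamming distance at most $m$). Let $P_{B,m}\subseteq W_B$ be the set of all $m$-almost-palindromes. Almost-palindromic width. Let $F$ be a free group with basis $B$ and $\phi_B\colon F_B\to F$ the canonical isomorphism.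 The set $X_{B,m}=\phi_B(r_B(P_{B,m}))$ generates $F$. The $m$-almost-palindromic width of $F$ is $\operatorname{AP-width}(F,m)=\operatorname{width}(F,X_{B,m})$; it does not depend on the choice of the basis $B$. A free group is non-abelian if it is neither trivial nor infinite cyclic. *)

theory Defs
  imports "HOL-Algebra.Elementary_Groups" "HOL-Library.Extended_Nat"
begin

section \<open>Words and the free group on a set\<close>

text \<open>The letter \<open>(b, True)\<close> stands for \<open>b\<close> and \<open>(b, False)\<close> for its formal inverse.\<close>

type_synonym 'b letter = "'b \<times> bool"

definition words :: "'b set \<Rightarrow> 'b letter list set" where
  "words B = lists (B \<times> UNIV)"

definition inv_letter :: "'b letter \<Rightarrow> 'b letter" where
  "inv_letter x = (fst x, \<not> snd x)"

definition reduced :: "'b letter list \<Rightarrow> bool" where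
  "reduced w \<longleftrightarrow> (\<forall>i. Suc i < length w \<longrightarrow> w ! Suc i \<noteq> inv_letter (w ! i))"

text \<open>Multiplication of a reduced word by a single letter on the left.\<close>

fun cons_reduce :: "'b letter \<Rightarrow> 'b letter list \<Rightarrow> 'b letter list" where
  "cons_reduce x [] = [x]"
| "cons_reduce x (y # w) = (if y = inv_letter x then w else x # y # w)"

definition reduce :: "'b letter list \<Rightarrow> 'b letter list" where
  "reduce w = foldr cons_reduce w []"

definition free_group_on :: "'b set \<Rightarrow> 'b letter list monoid" where
  "free_group_on B =
     \<lparr>carrier = {w \<in> words B. reduced w}, mult = (\<lambda>u v. reduce (u @ v)), one = []\<rparr>"

definition eval_letter :: "('a, 'c) monoid_scheme \<Rightarrow> 'a letter \<Rightarrow> 'a" where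
  "eval_letter G x = (if snd x then fst x else inv\<^bsub>G\<^esub> (fst x))"

text \<open>
  The product in \<open>G\<close> of the signed elements listed in a word. On the reduced words over a basis
  \<open>B\<close> of a free group this is the canonical isomorphism from the free group on the set \<open>B\<close>.
\<close>

definition eval_word :: "('a, 'c) monoid_scheme \<Rightarrow> 'a letter list \<Rightarrow> 'a" where
  "eval_word G w = foldr (\<lambda>x g. eval_letter G x \<otimes>\<^bsub>G\<^esub> g) w \<one>\<^bsub>G\<^esub>"

definition free_basis :: "('a, 'c) monoid_scheme \<Rightarrow> 'a set \<Rightarrow> bool" where
  "free_basis F B \<longleftrightarrow> B \<subseteq> carrier F \<and> eval_word F \<in> iso (free_group_on B) F"

section \<open>Width\<close>

text \<open>Meaningful only if \<open>X\<close> generates \<open>G\<close>; otherwise the minimum need not exist.\<close>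

definition gen_length :: "('a, 'c) monoid_scheme \<Rightarrow> 'a set \<Rightarrow> 'a \<Rightarrow> nat" where
  "gen_length G X g = (LEAST n. \<exists>w \<in> words X. length w = n \<and> eval_word G w = g)"

text \<open>
  In \<^typ>\<open>enat\<close> the supremum of a nonempty set of natural numbers is its maximum if that exists,
  and \<open>\<infinity>\<close> otherwise.
\<close>

definition width :: "('a, 'c) monoid_scheme \<Rightarrow> 'a set \<Rightarrow> enat" where
  "width G X = (SUP g \<in> carrier G. enat (gen_length G X g))"

section \<open>Almost-palindromes\<close>

definition palindrome :: "'b letter list \<Rightarrow> bool" where
  "palindrome p \<longleftrightarrow> rev p = p"

definition hamming_dist :: "'b list \<Rightarrow> 'b list \<Rightarrow> nat" where
  "hamming_dist u v = card {i. i < length u \<and> u ! i \<noteq> v ! i}"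

definition almost_palindromes :: "'b set \<Rightarrow> nat \<Rightarrow> 'b letter list set" where
  "almost_palindromes B m =
     {w \<in> words B. \<exists>p \<in> words B. palindrome p \<and> length p = length w \<and> hamming_dist w p \<le> m}"

definition AP_set :: "('a, 'c) monoid_scheme \<Rightarrow> 'a set \<Rightarrow> nat \<Rightarrow> 'a set" where
  "AP_set F B m = eval_word F ` reduce ` almost_palindromes B m"

text \<open>
  The value is the same for every basis \<open>B\<close> of \<open>F\<close>; the basis is kept as an argument so that
  this independence need not be presupposed.
\<close>

definition AP_width :: "('a, 'c) monoid_scheme \<Rightarrow> 'a set \<Rightarrow> nat \<Rightarrow> enat" where
  "AP_width F B m = width F (AP_set F B m)"

section \<open>The almost-palindromes generate\<close>

lemma eval_word_in_generate:
  assumes "group F" "B \<subseteq> carrier F" "w \<in> words B"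
  shows "eval_word F w \<in> generate F B"
  using assms(3)
proof (induction w)
  case Nil
  then show ?case by (simp add: eval_word_def generate.one)
next
  case (Cons x w)
  then have "fst x \<in> B" "eval_word F w \<in> generate F B"
    by (auto simp: words_def)
  then show ?case
    by (auto simp: eval_word_def eval_letter_def intro: generate.intros)
qed

lemma AP_set_generates:
  assumes "group F" "free_basis F B"
  shows "generate F (AP_set F B m) = carrier F"
proof -
  interpret F: group F by fact
  have B: "B \<subseteq> carrier F" and surj: "eval_word F ` carrier (free_group_on B) = carrier F"
    using assms(2) by (auto simp: free_basis_def iso_def bij_betw_def)
  have gB: "generate F B \<subseteq> carrier F"
    using B by (rule F.generate_incl)
  have red: "reduce w \<in> words B" if "w \<in> words B" for w
    using that
  proof (induction w)
    case (Cons x w)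
    then show ?case
      by (cases "reduce w") (auto simp: reduce_def words_def)
  qed (simp add: reduce_def)
  have X: "AP_set F B m \<subseteq> carrier F"
    using red eval_word_in_generate[OF assms(1) B] gB
    by (fastforce simp: AP_set_def almost_palindromes_def)
  have "B \<subseteq> AP_set F B m"
  proof
    fix b assume b: "b \<in> B"
    have "[(b, True)] \<in> almost_palindromes B m"
      using b by (auto simp: almost_palindromes_def words_def palindrome_def hamming_dist_def
          intro!: bexI[of _ "[(b, True)]"])
    moreover have "eval_word F (reduce [(b, True)]) = b"
      using b B by (auto simp: eval_word_def reduce_def eval_letter_def)
    ultimately show "b \<in> AP_set F B m"
      unfolding AP_set_def by (metis imageI)
  qed
  then have "generate F B \<subseteq> generate F (AP_set F B m)"
    by (rule F.mono_generate)
  moreover have "carrier F \<subseteq> generate F B"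
    using eval_word_in_generate[OF assms(1) B]
    by (auto simp: free_group_on_def simp flip: surj)
  ultimately show ?thesis
    using F.generate_incl[OF X] by blast
qed

end

theory Submission
  imports Defs
begin

text \<open>
  Fix two basis elements \<open>x \<noteq> y\<close>. On reduced words, count the subwords \<open>xy\<close> and
  \<open>x\<inverse>y\<inverse>\<close> with sign \<open>+\<close>, and \<open>yx\<close> and \<open>y\<inverse>x\<inverse>\<close> with sign \<open>-\<close>. This count \<open>f\<close> is a
  quasimorphism of defect at most 3, and it changes sign both under inversion and under reversal of
  words. Hence it vanishes on palindromes. Changing one letter of a word moves \<open>f\<close> by at
  most 12, so \<open>\<bar>f\<bar> \<le> 12 m\<close> on \<open>m\<close>-almost-palindromes, and \<open>\<bar>f\<bar> \<le> (12 m + 3) k\<close> on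
  products of \<open>k\<close> of them and their inverses. But \<open>f\<close> is \<open>2 n\<close> on the \<open>n\<close>-th power of the commutator of
  \<open>x\<close> and \<open>y\<close>.
\<close>

section \<open>Reduction of words\<close>

lemma inv_letter_inv_letter [simp]: "inv_letter (inv_letter a) = a"
  by (simp add: inv_letter_def)

lemma inv_letter_eq_iff: "inv_letter a = b \<longleftrightarrow> a = inv_letter b"
  by auto

lemma inv_letter_inject [simp]: "inv_letter a = inv_letter b \<longleftrightarrow> a = b"
  by (auto simp: inv_letter_eq_iff)

lemma reduced_iff_successively: "reduced w \<longleftrightarrow> successively (\<lambda>a b. b \<noteq> inv_letter a) w"
  by (simp add: reduced_def successively_conv_nth)

lemma reduced_Nil [simp]: "reduced []"
  by (simp add: reduced_iff_successively)

lemma reduced_single [simp]: "reduced [a]"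
  by (simp add: reduced_iff_successively)

lemma reduced_Cons_Cons [simp]:
  "reduced (a # b # w) \<longleftrightarrow> b \<noteq> inv_letter a \<and> reduced (b # w)"
  by (simp add: reduced_iff_successively)

lemma reduced_ConsD: "reduced (a # w) \<Longrightarrow> reduced w"
  by (cases w) auto

lemma reduced_append_iff:
  "reduced (u @ v) \<longleftrightarrow>
     reduced u \<and> reduced v \<and> (u = [] \<or> v = [] \<or> hd v \<noteq> inv_letter (last u))"
  by (auto simp: reduced_iff_successively successively_append_iff)

lemma reduced_rev [simp]: "reduced (rev w) \<longleftrightarrow> reduced w"
proof -
  have "(\<lambda>a b. a \<noteq> inv_letter b) = (\<lambda>a b. b \<noteq> inv_letter a)"
    by (auto simp: fun_eq_iff inv_letter_eq_iff)
  then show ?thesis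
    unfolding reduced_iff_successively successively_rev by (rule arg_cong)
qed

section \<open>Left multiplication by letters and uniqueness of reduced forms\<close>

lemma reduced_cons_reduce: "reduced w \<Longrightarrow> reduced (cons_reduce a w)"
  by (cases w) (auto dest: reduced_ConsD)

lemma cons_reduce_reduced: "reduced (a # w) \<Longrightarrow> cons_reduce a w = a # w"
  by (cases w) auto

text \<open>If \<open>w\<close> starts with \<open>a\<close>, then \<open>b\<close> deletes this
  letter and \<open>a\<close> restores it; the restored letter is not cancelled again because
  \<open>w\<close> is reduced.\<close>

lemma cons_reduce_cancel:
  "reduced w \<Longrightarrow> b = inv_letter a \<Longrightarrow> cons_reduce a (cons_reduce b w) = w"
  by (cases w) (auto intro!: cons_reduce_reduced)

lemma reduce_Nil [simp]: "reduce [] = []"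
  by (simp add: reduce_def)

lemma reduce_Cons [simp]: "reduce (a # w) = cons_reduce a (reduce w)"
  by (simp add: reduce_def)

lemma reduced_reduce [simp]: "reduced (reduce w)"
  by (induction w) (auto intro: reduced_cons_reduce)

lemma reduce_reduced: "reduced w \<Longrightarrow> reduce w = w"
proof (induction w)
  case (Cons a w)
  then show ?case
    using reduced_ConsD[OF Cons.prems] by (simp add: cons_reduce_reduced)
qed simp

lemma reduce_append: "reduce (u @ v) = foldr cons_reduce u (reduce v)"
  by (simp add: reduce_def)

lemma reduce_append_right: "reduce (u @ reduce v) = reduce (u @ v)"
  by (simp add: reduce_append reduce_reduced)

lemma reduce_append_left: "reduce (reduce u @ v) = reduce (u @ v)"
proof (induction u)
  case (Cons a u)
  show ?case
  proof (cases "reduce u")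
    case Nil
    then show ?thesis
      using Cons by simp
  next
    case (Cons b r)
    then show ?thesis
      using Cons.IH by (auto simp: cons_reduce_cancel simp flip: Cons.IH)
  qed
qed simp

lemma reduce_cancel: "reduce (u @ a # inv_letter a # v) = reduce (u @ v)"
  by (simp add: reduce_append cons_reduce_cancel)

text \<open>\<open>reduce\<close> works from the right end, so reversal needs an argument: a letter
  \<open>a\<close> appended to the reduced word \<open>rev (reduce w)\<close> either cancels its
  last letter or leaves a reduced word.\<close>

lemma reduce_rev: "reduce (rev w) = rev (reduce w)"
proof (induction w)
  case (Cons a w)
  have eq: "reduce (rev (a # w)) = reduce (rev (reduce w) @ [a])"
    by (metis Cons reduce_append_left rev.simps(2))
  have red: "reduced (reduce w)" by simp
  show ?case
  proof (cases "reduce w")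
    case Nil
    then show ?thesis using eq by simp
  next
    case (Cons b r)
    show ?thesis
    proof (cases "b = inv_letter a")
      case True
      have "reduced (rev r)"
        using red Cons by (auto dest: reduced_ConsD)
      then show ?thesis
        using reduce_cancel[of "rev r" "inv_letter a" "[]"] True Cons
        by (simp add: eq reduce_reduced del: rev.simps) (simp add: reduce_reduced)
    next
      case False
      then have "reduced (a # b # r)" using red Cons by simp
      then have "reduced (rev (a # b # r))" by (simp only: reduced_rev)
      then have "reduce (rev (a # b # r)) = rev (a # b # r)" by (rule reduce_reduced)
      then show ?thesis
        using eq False Cons by simp
    qed
  qed
qed simp

lemma reduce_map_inv_letter: "reduce (map inv_letter w) = map inv_letter (reduce w)"
proof (induction w)
  case (Cons a w)
  then show ?case by (cases "reduce w") auto
qed simp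

text \<open>Here \<open>c\<close> is the part of \<open>u\<close> that cancels against the start of
  \<open>v\<close>. Cancellation begins at the last letter of \<open>u\<close>, hence the induction
  from the right.\<close>

lemma reduced_cancellation:
  assumes "reduced u" "reduced v"
  obtains u' c v' where "u = u' @ c" "v = rev (map inv_letter c) @ v'" "reduced (u' @ v')"
  using assms
proof (induction u arbitrary: v thesis rule: rev_induct)
  case Nil
  then show ?case by force
next
  case (snoc a u)
  show ?case
  proof (cases "\<exists>v1. v = inv_letter a # v1")
    case True
    then obtain v1 where v: "v = inv_letter a # v1" by blast
    have "reduced u" "reduced v1"
      using snoc.prems v by (auto simp: reduced_append_iff dest: reduced_ConsD)
    then obtain u' c v' where *: "u = u' @ c" "v1 = rev (map inv_letter c) @ v'" "reduced (u' @ v')"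
      using snoc.IH by blast
    show ?thesis
      by (rule snoc.prems(1)[of u' "c @ [a]" v']) (use * v in auto)
  next
    case False
    then have "v = [] \<or> hd v \<noteq> inv_letter (last (u @ [a]))"
      by (cases v) auto
    then have "reduced ((u @ [a]) @ v)"
      using snoc.prems by (subst reduced_append_iff) simp
    then show ?thesis
      by (intro snoc.prems(1)[of "u @ [a]" "[]" v]) simp_all
  qed
qed

section \<open>The quasimorphism\<close>

definition pair_weight :: "'b \<Rightarrow> 'b \<Rightarrow> 'b letter \<Rightarrow> 'b letter \<Rightarrow> int" where
  "pair_weight x y a b =
     (if snd a \<noteq> snd b then 0
      else if fst a = x \<and> fst b = y then 1
      else if fst a = y \<and> fst b = x then -1
      else 0)"

fun pair_count :: "'b \<Rightarrow> 'b \<Rightarrow> 'b letter list \<Rightarrow> int" where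
  "pair_count x y (a # b # w) = pair_weight x y a b + pair_count x y (b # w)"
| "pair_count x y _ = 0"

lemma abs_pair_weight: "\<bar>pair_weight x y a b\<bar> \<le> 1"
  by (simp add: pair_weight_def)

text \<open>For \<open>x = y\<close> this fails: the first test would give 1 in both orders.\<close>

lemma pair_weight_swap: "x \<noteq> y \<Longrightarrow> pair_weight x y b a = - pair_weight x y a b"
  by (auto simp: pair_weight_def)

lemma pair_weight_inv_letter [simp]:
  "pair_weight x y (inv_letter a) (inv_letter b) = pair_weight x y a b"
  by (simp add: pair_weight_def inv_letter_def)

lemma pair_count_append:
  "pair_count x y (u @ v) = pair_count x y u + pair_count x y v +
     (if u = [] \<or> v = [] then 0 else pair_weight x y (last u) (hd v))"
proof (induction u)
  case (Cons a u)
  then show ?case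
    by (cases u; cases v) auto
qed simp

lemma pair_count_append_approx:
  "\<bar>pair_count x y (u @ v) - pair_count x y u - pair_count x y v\<bar> \<le> 1"
  using abs_pair_weight[of x y "last u" "hd v"] by (simp add: pair_count_append)

lemma pair_count_rev: "x \<noteq> y \<Longrightarrow> pair_count x y (rev w) = - pair_count x y w"
proof (induction w)
  case (Cons a w)
  then show ?case
    by (cases w) (auto simp: pair_count_append pair_weight_swap[of x y a])
qed simp

lemma pair_count_map_inv_letter: "pair_count x y (map inv_letter w) = pair_count x y w"
  by (induction w rule: pair_count.induct[of _ x y]) auto

section \<open>The count on reduced forms and its defect\<close>

definition quasi :: "'b \<Rightarrow> 'b \<Rightarrow> 'b letter list \<Rightarrow> int" where
  "quasi x y w = pair_count x y (reduce w)"

lemma quasi_rev: "x \<noteq> y \<Longrightarrow> quasi x y (rev w) = - quasi x y w"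
  by (simp add: quasi_def reduce_rev pair_count_rev)

lemma quasi_inverse: "x \<noteq> y \<Longrightarrow> quasi x y (map inv_letter (rev w)) = - quasi x y w"
  by (simp add: quasi_def reduce_map_inv_letter reduce_rev pair_count_map_inv_letter pair_count_rev)

lemma quasi_Nil [simp]: "quasi x y [] = 0"
  by (simp add: quasi_def)

lemma quasi_single [simp]: "quasi x y [a] = 0"
  by (simp add: quasi_def)

text \<open>With \<open>c\<close> the cancelled part, the contributions of \<open>c\<close> and its
  inverse add up to 0. What remains is one junction in each of the two factors and one in the
  product, each of weight at most 1.\<close>

lemma quasi_append:
  assumes "x \<noteq> y"
  shows "\<bar>quasi x y (u @ v) - quasi x y u - quasi x y v\<bar> \<le> 3"
proof -
  obtain u' c v' where dec: "reduce u = u' @ c" "reduce v = rev (map inv_letter c) @ v'"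
      "reduced (u' @ v')"
    using reduced_cancellation[of "reduce u" "reduce v"] by auto
  have cancel: "reduce (s @ c @ rev (map inv_letter c) @ t) = reduce (s @ t)" for s t
  proof (induction c arbitrary: s t)
    case (Cons a c)
    \<comment> \<open>By induction the inner block vanishes, with \<open>a\<close> and its inverse
      counted to the outer words; then these two letters meet and cancel.\<close>
    show ?case
      using Cons[of "s @ [a]" "inv_letter a # t"] by (simp add: reduce_cancel)
  qed simp
  have "reduce (u @ v) = reduce (reduce u @ reduce v)"
    by (simp add: reduce_append_left reduce_append_right)
  also have "\<dots> = u' @ v'"
    using dec cancel[of u' v'] by (simp add: reduce_reduced)
  finally have uv: "reduce (u @ v) = u' @ v'" .
  have "pair_count x y (rev (map inv_letter c)) = - pair_count x y c"
    using assms by (simp add: pair_count_rev pair_count_map_inv_letter)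
  then show ?thesis
    unfolding quasi_def uv dec(1,2)
    using pair_count_append_approx[of x y u' v'] pair_count_append_approx[of x y u' c]
      pair_count_append_approx[of x y "rev (map inv_letter c)" v']
    by linarith
qed

section \<open>Boundedness on almost-palindromes\<close>

text \<open>Each of the two words is cut twice to isolate its letter, at cost 3 per cut; single
  letters have value 0. This gives 4 * 3 = 12.\<close>

lemma quasi_change_letter:
  assumes "x \<noteq> y"
  shows "\<bar>quasi x y (u @ a # v) - quasi x y (u @ b # v)\<bar> \<le> 12"
  using quasi_append[OF assms, of u "[a] @ v"] quasi_append[OF assms, of "[a]" v]
    quasi_append[OF assms, of u "[b] @ v"] quasi_append[OF assms, of "[b]" v]
  by simp

lemma quasi_hamming:
  assumes "x \<noteq> y" "length u = length v"
  shows "\<bar>quasi x y u - quasi x y v\<bar> \<le> 12 * int (hamming_dist u v)"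
  using assms(2)
proof (induction "hamming_dist u v" arbitrary: u)
  case 0
  then have "u = v"
    by (auto simp: hamming_dist_def intro: nth_equalityI)
  then show ?case by simp
next
  case (Suc d)
  let ?D = "\<lambda>u. {i. i < length u \<and> u ! i \<noteq> v ! i}"
  from Suc.hyps(2) have "?D u \<noteq> {}"
    unfolding hamming_dist_def by (metis card.empty nat.distinct(1))
  then obtain i where i: "i < length u" "u ! i \<noteq> v ! i" by blast
  \<comment> \<open>Correcting one differing position lowers the distance by exactly one.\<close>
  define u' where "u' = u[i := v ! i]"
  have "?D u' = ?D u - {i}"
    using i by (auto simp: u'_def nth_list_update)
  then have "d = hamming_dist u' v"
    using Suc.hyps(2) i by (simp add: hamming_dist_def)
  moreover have "length u' = length v"
    using Suc.prems by (simp add: u'_def)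
  ultimately have "\<bar>quasi x y u' - quasi x y v\<bar> \<le> 12 * int d"
    using Suc.hyps(1) by metis
  moreover have "\<bar>quasi x y u - quasi x y u'\<bar> \<le> 12"
    using quasi_change_letter[OF assms(1), of "take i u" "u ! i" "drop (Suc i) u" "v ! i"] i
    by (simp add: u'_def upd_conv_take_nth_drop id_take_nth_drop[symmetric])
  ultimately show ?case
    using Suc.hyps(2) by linarith
qed

text \<open>On a palindrome \<open>quasi\<close> equals its own negative, so it is 0; at most
  \<open>m\<close> letter changes follow.\<close>

lemma quasi_almost_palindrome:
  assumes "x \<noteq> y" "w \<in> almost_palindromes B m"
  shows "\<bar>quasi x y w\<bar> \<le> 12 * int m"
proof -
  obtain p where p: "palindrome p" "length p = length w" "hamming_dist w p \<le> m"
    using assms(2) by (auto simp: almost_palindromes_def)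
  have "quasi x y p = 0"
    using quasi_rev[OF assms(1), of p] p(1) by (simp add: palindrome_def)
  then show ?thesis
    using quasi_hamming[OF assms(1), of w p] p by simp
qed

section \<open>Unboundedness on powers of a commutator\<close>

definition commutator_word :: "'b \<Rightarrow> 'b \<Rightarrow> 'b letter list" where
  "commutator_word x y = [(x, True), (y, True), (x, False), (y, False)]"

lemma quasi_commutator_power:
  assumes "x \<noteq> y"
  shows "quasi x y (concat (replicate n (commutator_word x y))) = 2 * int n"
proof -
  let ?w = "\<lambda>n. concat (replicate n (commutator_word x y))"
  \<comment> \<open>Consecutive commutators meet in the inverse of \<open>y\<close> followed by
    \<open>x\<close>. This pair does not cancel, as \<open>x \<noteq> y\<close>, and has weight 0,
    as the signs differ. The same holds for the middle pair inside each commutator, so only its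
    outer two pairs count.\<close>
  have hd: "hd (?w n) = (x, True)" if "?w n \<noteq> []" for n
    using that by (cases n) (auto simp: commutator_word_def)
  have "reduced (?w n) \<and> pair_count x y (?w n) = 2 * int n"
  proof (induction n)
    case (Suc n)
    have "reduced (commutator_word x y)" "pair_count x y (commutator_word x y) = 2"
      using assms by (auto simp: commutator_word_def inv_letter_def pair_weight_def)
    moreover have "last (commutator_word x y) = (y, False)"
      by (simp add: commutator_word_def)
    ultimately show ?case
      using Suc assms hd[of n]
      by (auto simp: reduced_append_iff pair_count_append inv_letter_def pair_weight_def)
  qed simp
  then show ?thesis
    by (simp add: quasi_def reduce_reduced)
qed

section \<open>Evaluation of words\<close>

lemma words_Nil [simp]: "[] \<in> words B"
  by (simp add: words_def)

lemma words_Cons [simp]: "a # w \<in> words B \<longleftrightarrow> fst a \<in> B \<and> w \<in> words B"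
  by (cases a) (simp add: words_def)

lemma words_append [simp]: "u @ v \<in> words B \<longleftrightarrow> u \<in> words B \<and> v \<in> words B"
  by (auto simp: words_def)

lemma words_inverse: "w \<in> words B \<Longrightarrow> map inv_letter (rev w) \<in> words B"
  by (induction w) (auto simp: inv_letter_def)

lemma words_reduce: "w \<in> words B \<Longrightarrow> reduce w \<in> words B"
proof (induction w)
  case (Cons a w)
  then show ?case
    by (cases "reduce w") auto
qed simp

lemma words_concat_replicate: "w \<in> words B \<Longrightarrow> concat (replicate n w) \<in> words B"
  by (induction n) auto

lemma eval_word_Nil [simp]: "eval_word G [] = \<one>\<^bsub>G\<^esub>"
  by (simp add: eval_word_def)

lemma eval_word_Cons [simp]: "eval_word G (a # w) = eval_letter G a \<otimes>\<^bsub>G\<^esub> eval_word G w"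
  by (simp add: eval_word_def)

context group
begin

lemma eval_letter_closed [simp]: "fst a \<in> carrier G \<Longrightarrow> eval_letter G a \<in> carrier G"
  by (simp add: eval_letter_def)

lemma eval_letter_inv_letter [simp]:
  "fst a \<in> carrier G \<Longrightarrow> eval_letter G (inv_letter a) = inv (eval_letter G a)"
  by (simp add: eval_letter_def inv_letter_def)

lemma eval_word_closed [simp]: "w \<in> words (carrier G) \<Longrightarrow> eval_word G w \<in> carrier G"
  by (induction w) auto

lemma eval_word_append:
  "u \<in> words (carrier G) \<Longrightarrow> v \<in> words (carrier G) \<Longrightarrow>
     eval_word G (u @ v) = eval_word G u \<otimes> eval_word G v"
  by (induction u) (auto simp: m_assoc)

lemma eval_word_inverse:
  "w \<in> words (carrier G) \<Longrightarrow> eval_word G (map inv_letter (rev w)) = inv (eval_word G w)"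
proof (induction w)
  case (Cons a w)
  then show ?case
    using words_inverse[of w "carrier G"] words_inverse[of "[a]" "carrier G"]
    by (simp add: eval_word_append inv_mult_group)
qed simp

lemma eval_word_reduce:
  "w \<in> words (carrier G) \<Longrightarrow> eval_word G (reduce w) = eval_word G w"
proof (induction w)
  case (Cons a w)
  have w: "reduce w \<in> words (carrier G)"
    using Cons.prems by (intro words_reduce) simp
  show ?case
  proof (cases "reduce w")
    case Nil
    then show ?thesis using Cons by simp
  next
    case (Cons b r)
    then show ?thesis
      using w Cons.IH Cons.prems by (auto simp: m_assoc[symmetric] simp flip: Cons.IH)
  qed
qed simp

text \<open>Ensures that the minimum in \<open>gen_length\<close> is taken over a nonempty
  set.\<close>

lemma generate_eval_word:
  assumes "X \<subseteq> carrier G" "g \<in> generate G X"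
  shows "\<exists>w \<in> words X. eval_word G w = g"
  using assms(2)
proof induction
  case one
  then show ?case by (intro bexI[of _ "[]"]) auto
next
  case (incl g)
  then show ?case
    using assms(1) by (intro bexI[of _ "[(g, True)]"]) (auto simp: eval_letter_def)
next
  case (inv g)
  then show ?case
    using assms(1) by (intro bexI[of _ "[(g, False)]"]) (auto simp: eval_letter_def)
next
  case (eng g h)
  then obtain u v where "u \<in> words X" "v \<in> words X" "eval_word G u = g" "eval_word G v = h"
    by blast
  moreover have "words X \<subseteq> words (carrier G)"
    using assms(1) by (auto simp: words_def lists_mono)
  ultimately show ?case
    by (intro bexI[of _ "u @ v"]) (auto simp: eval_word_append subsetD)
qed

text \<open>Used to see that a free group with a one-element basis is cyclic.\<close>

lemma eval_word_singleton_basis: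
  assumes "b \<in> carrier G" "w \<in> words {b}"
  shows "eval_word G w \<in> range (\<lambda>n::int. b [^] n)"
  using assms(2)
proof (induction w)
  case Nil
  then show ?case by (auto intro: range_eqI[of _ _ 0])
next
  case (Cons a w)
  then obtain n :: int where n: "eval_word G w = b [^] n" and "fst a = b" by auto
  then have "eval_letter G a = b [^] (if snd a then 1 else - 1 :: int)"
    using assms(1) by (simp add: eval_letter_def int_pow_neg)
  then have "eval_word G (a # w) = b [^] ((if snd a then 1 else - 1) + n)"
    using n assms(1) by (simp add: int_pow_mult)
  then show ?case by blast
qed

text \<open>The letters of \<open>w\<close> are themselves group elements. Spelling each one over
  \<open>B\<close> by an almost-palindrome or its inverse and concatenating costs
  \<open>12 * m\<close> for the value and 3 for the defect, per letter.\<close>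

lemma eval_word_AP_set:
  assumes "x \<noteq> y" "B \<subseteq> carrier G" "w \<in> words (AP_set G B m)"
  shows "\<exists>u \<in> words B. eval_word G u = eval_word G w \<and>
           \<bar>quasi x y u\<bar> \<le> int (length w) * (12 * int m + 3)"
  using assms(3)
proof (induction w)
  case (Cons a w)
  have sub: "words B \<subseteq> words (carrier G)"
    using assms(2) by (auto simp: words_def lists_mono)
  obtain u where u: "u \<in> words B" "eval_word G u = eval_word G w"
      "\<bar>quasi x y u\<bar> \<le> int (length w) * (12 * int m + 3)"
    using Cons by auto
  obtain p where p: "p \<in> almost_palindromes B m" "fst a = eval_word G (reduce p)"
    using Cons.prems by (auto simp: AP_set_def)
  have pB: "p \<in> words B"
    using p(1) by (simp add: almost_palindromes_def)
  then have p_eval: "fst a = eval_word G p"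
    using p(2) sub eval_word_reduce by auto
  \<comment> \<open>A negative letter is spelled by the formal inverse of \<open>p\<close>, which
    only changes the sign of \<open>quasi\<close>.\<close>
  define q where "q = (if snd a then p else map inv_letter (rev p))"
  have q: "q \<in> words B" "eval_word G q = eval_letter G a" "\<bar>quasi x y q\<bar> \<le> 12 * int m"
    using pB p_eval sub quasi_almost_palindrome[OF assms(1) p(1)] words_inverse[OF pB]
    by (auto simp: q_def eval_letter_def eval_word_inverse subsetD quasi_inverse[OF assms(1)])
  have "eval_word G (q @ u) = eval_word G (a # w)"
    using q u sub by (simp add: eval_word_append subsetD)
  moreover have "\<bar>quasi x y (q @ u)\<bar> \<le> int (length (a # w)) * (12 * int m + 3)"
    using quasi_append[OF assms(1), of q u] q(3) u(3) by (simp add: algebra_simps)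
  ultimately show ?case
    using q(1) u(1) by (intro bexI[of _ "q @ u"]) auto
qed (auto intro: bexI[of _ "[]"])

lemma gen_length_attained:
  assumes "X \<subseteq> carrier G" "g \<in> generate G X"
  shows "\<exists>w \<in> words X. length w = gen_length G X g \<and> eval_word G w = g"
  unfolding gen_length_def
  by (rule LeastI_ex) (use generate_eval_word[OF assms] in blast)

end

section \<open>Free groups\<close>

lemma free_basis_inj:
  "free_basis F B \<Longrightarrow> inj_on (eval_word F) {w \<in> words B. reduced w}"
  by (simp add: free_basis_def iso_def bij_betw_def free_group_on_def)

lemma free_basis_carrier:
  "free_basis F B \<Longrightarrow> carrier F = eval_word F ` {w \<in> words B. reduced w}"
  by (simp add: free_basis_def iso_def bij_betw_def free_group_on_def)

text \<open>The positive powers of \<open>b\<close> are pairwise distinct reduced words, which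
  \<open>eval_word F\<close> keeps distinct.\<close>

lemma free_basis_infinite:
  assumes "free_basis F B" "b \<in> B"
  shows "infinite (carrier F)"
proof -
  let ?w = "\<lambda>n. replicate n (b, True)"
  have "reduced (?w n)" for n
    by (auto simp: reduced_def inv_letter_def)
  moreover have "?w n \<in> words B" for n
    using assms(2) by (auto simp: words_def)
  ultimately have "range ?w \<subseteq> {w \<in> words B. reduced w}"
    by auto
  moreover have "inj ?w"
    by (auto intro!: injI simp: replicate_eq_replicate)
  then have "infinite (range ?w)"
    by (rule range_inj_infinite)
  ultimately have "infinite {w \<in> words B. reduced w}"
    by (meson finite_subset)
  then show ?thesis
    using free_basis_inj[OF assms(1)] by (simp add: free_basis_carrier[OF assms(1)] finite_image_iff)
qed

text \<open>An empty basis would make the group trivial, a singleton basis would make it infinite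
  cyclic.\<close>

lemma free_basis_two_elements:
  assumes "group F" "free_basis F B" "\<not> trivial_group F"
    and "\<not> (cyclic_group F \<and> infinite (carrier F))"
  obtains x y where "x \<in> B" "y \<in> B" "x \<noteq> y"
proof -
  interpret F: group F by fact
  have B: "B \<subseteq> carrier F" using assms(2) by (simp add: free_basis_def)
  have "B \<noteq> {}"
  proof
    assume "B = {}"
    then have "carrier F \<subseteq> {\<one>\<^bsub>F\<^esub>}"
      by (auto simp: free_basis_carrier[OF assms(2)] words_def)
    then show False
      using assms(3) F.trivial_group_subset by blast
  qed
  moreover have "B \<noteq> {b}" for b
  proof
    assume b: "B = {b}"
    then have bF: "b \<in> carrier F" using B by simp
    have "carrier F \<subseteq> range (\<lambda>n::int. b [^]\<^bsub>F\<^esub> n)"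
      using F.eval_word_singleton_basis[OF bF] b
      by (auto simp: free_basis_carrier[OF assms(2)])
    moreover have "range (\<lambda>n::int. b [^]\<^bsub>F\<^esub> n) \<subseteq> carrier F"
      using bF by auto
    ultimately have "cyclic_group F"
      using bF F.cyclic_group by blast
    then show False
      using assms(4) free_basis_infinite[OF assms(2), of b] b by simp
  qed
  ultimately show thesis
    using that by blast
qed

theorem theorem1:
  fixes F :: "('a, 'c) monoid_scheme" and B :: "'a set" and m :: nat
  assumes "group F"
    and "free_basis F B"
    and "\<not> trivial_group F"
    and "\<not> (cyclic_group F \<and> infinite (carrier F))"
  shows "AP_width F B m = \<infinity>"
proof (rule ccontr)
  interpret F: group F by fact
  assume "AP_width F B m \<noteq> \<infinity>"
  then obtain N where N: "AP_width F B m = enat N" by auto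
  obtain x y where xy: "x \<in> B" "y \<in> B" "x \<noteq> y"
    using free_basis_two_elements[OF assms] .
  have B: "B \<subseteq> carrier F" using assms(2) by (simp add: free_basis_def)
  have gen: "generate F (AP_set F B m) = carrier F"
    using AP_set_generates[OF assms(1,2)] .
  have X: "AP_set F B m \<subseteq> carrier F"
    using gen generate.incl[of _ "AP_set F B m" F] by blast
  \<comment> \<open>Chosen so that \<open>n\<close>, and hence the value \<open>2 * n\<close> on the
    commutator power, exceeds the bound \<open>N * (12 * m + 3)\<close> for products of at most
    \<open>N\<close> factors; the summand 1 makes this strict.\<close>
  define n where "n = N * (12 * m + 3) + 1"
  define c where "c = concat (replicate n (commutator_word x y))"
  have cB: "c \<in> words B"
    unfolding c_def using xy by (intro words_concat_replicate) (simp add: commutator_word_def)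
  have sub: "words B \<subseteq> words (carrier F)"
    using B by (auto simp: words_def lists_mono)
  have cF: "eval_word F c \<in> carrier F"
    using cB sub by auto
  then have "enat (gen_length F (AP_set F B m) (eval_word F c)) \<le> enat N"
    unfolding N[symmetric] AP_width_def width_def by (rule SUP_upper)
  then obtain w where w: "w \<in> words (AP_set F B m)" "length w \<le> N" "eval_word F w = eval_word F c"
    using F.gen_length_attained[OF X, of "eval_word F c"] cF gen by auto
  obtain u where u: "u \<in> words B" "eval_word F u = eval_word F c"
      "\<bar>quasi x y u\<bar> \<le> int (length w) * (12 * int m + 3)"
    using F.eval_word_AP_set[OF xy(3) B w(1)] w(3) by auto
  \<comment> \<open>Injectivity of \<open>eval_word F\<close> is available on reduced words only.
    Since \<open>quasi\<close> depends only on the reduced form, equality of reduced forms suffices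
    to transfer its value from \<open>c\<close> to \<open>u\<close>.\<close>
  have "eval_word F (reduce u) = eval_word F (reduce c)"
    using u(1,2) cB sub by (simp add: F.eval_word_reduce subsetD)
  then have "reduce u = reduce c"
    using inj_onD[OF free_basis_inj[OF assms(2)]] u(1) cB by (simp add: words_reduce)
  then have "quasi x y u = 2 * int n"
    using quasi_commutator_power[OF xy(3), of n] by (simp add: quasi_def c_def)
  moreover have "int (length w) * (12 * int m + 3) \<le> int N * (12 * int m + 3)"
    using w(2) by (intro mult_right_mono) auto
  moreover have "int n = int N * (12 * int m + 3) + 1"
    by (simp add: n_def)
  ultimately show False
    using u(3) by (smt (verit) of_nat_0_le_iff)
qed

end
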